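(* Let $p\geq 3$ be a prime and $n\geq 2$ be an integer. Then $\mathfrak{g}(\mathbb{F}_p^n)\leq 2p\cdot r(\mathbb{F}_p^{n-1})$.
   Context: For a finite abelian group $G$ (written additively), $\exp(G)$ denotes its exponent, i.e. the least common multiple of the orders of all elements of $G$; in particular $\exp(\mathbb{F}_p^n)=p$. For a non-trivial finite abelian group $G$, $\mathfrak{g}(G)$ denotes the smallest integer $a$ such that every subset $A\subseteq G$ of size $|A|\geq a$ contains $\exp(G)$ distinct elements summing to zero in $G$. A three-term arithmetic progression in $G$ is a set $\{x,y,z\}\subseteq G$ with $x,y,z$ distinct and $x+z=2y$. For a finite abelian group $G$, $r(G)$ denotes the largest size of a subset of $G$ that does not contain a three-term arithmetic progression. $\mathbb{F}_p^n$ is regarded as an additive group. *)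

theory Defs
  imports "HOL-Algebra.Product_Groups" "HOL-Number_Theory.Residues"
begin

text \<open>
  Abelian groups are those of \<open>HOL-Algebra\<close>, which writes every group multiplicatively:
  \<open>x \<otimes>\<^bsub>G\<^esub> z\<close> stands for \<open>x + z\<close>, \<open>y [^]\<^bsub>G\<^esub> 2\<close> for \<open>2 y\<close>, \<open>finprod G\<close> for a sum, \<open>\<one>\<^bsub>G\<^esub>\<close> for \<open>0\<close>.
\<close>

definition group_exponent :: "('a, 'b) monoid_scheme \<Rightarrow> nat" where
  "group_exponent G = Lcm (group.ord G ` carrier G)"

text \<open>
  Meant for finite abelian \<open>G\<close>. Then the \<open>LEAST\<close> exists (any \<open>a\<close> above the order of \<open>G\<close> qualifies),
  and it is also the least integer with the property: \<open>a = 0\<close> fails already, as the exponent is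
  positive.
\<close>
definition zero_sum_const :: "('a, 'b) monoid_scheme \<Rightarrow> nat" where
  "zero_sum_const G = (LEAST a. \<forall>A. A \<subseteq> carrier G \<and> a \<le> card A \<longrightarrow>
     (\<exists>S\<subseteq>A. card S = group_exponent G \<and> finprod G (\<lambda>x. x) S = \<one>\<^bsub>G\<^esub>))"

definition three_term_AP :: "('a, 'b) monoid_scheme \<Rightarrow> 'a set \<Rightarrow> bool" where
  "three_term_AP G T \<longleftrightarrow> (\<exists>x\<in>carrier G. \<exists>y\<in>carrier G. \<exists>z\<in>carrier G.
     T = {x, y, z} \<and> x \<noteq> y \<and> y \<noteq> z \<and> x \<noteq> z \<and> x \<otimes>\<^bsub>G\<^esub> z = y [^]\<^bsub>G\<^esub> (2 :: nat))"

definition max_AP_free :: "('a, 'b) monoid_scheme \<Rightarrow> nat" where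
  "max_AP_free G = Max {card A |A. A \<subseteq> carrier G \<and> \<not> (\<exists>T\<subseteq>A. three_term_AP G T)}"

definition Fp_power :: "nat \<Rightarrow> nat \<Rightarrow> (nat \<Rightarrow> int) monoid" where
  "Fp_power p n = product_group {..<n} (\<lambda>_. add_monoid (residue_ring (int p)))"

lemma comm_group_Fp_power:
  assumes "p \<ge> 2"
  shows "comm_group (Fp_power p n)"
proof -
  interpret residues "int p" "residue_ring (int p)"
    using assms by unfold_locales auto
  have "group (Fp_power p n)"
    unfolding Fp_power_def by (intro product_group a_group)
  then show ?thesis
    by (rule group.group_comm_groupI)
      (auto simp: Fp_power_def product_group_def residue_ring_def fun_eq_iff add.commute)
qed

lemma order_Fp_power: "order (Fp_power p n) = p ^ n"
  by (simp add: order_def Fp_power_def product_group_def residue_ring_def card_PiE)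

lemma pow_Fp_power:
  assumes "p \<ge> 2" "x \<in> carrier (Fp_power p n)"
  shows "x [^]\<^bsub>Fp_power p n\<^esub> k = (\<lambda>i\<in>{..<n}. (int k * x i) mod int p)"
proof (induction k)
  case 0
  then show ?case by (simp add: Fp_power_def product_group_def residue_ring_def)
next
  case (Suc k)
  interpret comm_group "Fp_power p n" by (rule comm_group_Fp_power[OF assms(1)])
  show ?case
    unfolding nat_pow_Suc Suc
    by (auto simp: Fp_power_def product_group_def residue_ring_def fun_eq_iff mod_add_right_eq
        algebra_simps)
qed

lemma group_exponent_Fp_power:
  assumes "prime p" "n \<ge> 1"
  shows "group_exponent (Fp_power p n) = p"
proof -
  have p2: "p \<ge> 2" using assms(1) by (rule prime_ge_2_nat)
  interpret comm_group "Fp_power p n" by (rule comm_group_Fp_power[OF p2])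
  have one: "\<one>\<^bsub>Fp_power p n\<^esub> = (\<lambda>i\<in>{..<n}. 0)"
    by (simp add: Fp_power_def product_group_def residue_ring_def)
  let ?e = "\<lambda>i\<in>{..<n}. 1 :: int"
  have e: "?e \<in> carrier (Fp_power p n)"
    using p2 by (auto simp: Fp_power_def product_group_def residue_ring_def)
  have "ord x dvd p" if "x \<in> carrier (Fp_power p n)" for x
    unfolding pow_eq_id[OF that, symmetric] by (auto simp: pow_Fp_power[OF p2 that] one fun_eq_iff)
  moreover have "ord ?e \<noteq> 1"
  proof
    assume "ord ?e = 1"
    then have "?e [^]\<^bsub>Fp_power p n\<^esub> (1 :: nat) = \<one>\<^bsub>Fp_power p n\<^esub>"
      using pow_eq_id[OF e, of 1] by (simp del: nat_pow_Suc)
    then have "?e 0 = (\<lambda>i\<in>{..<n}. 0) 0"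
      by (simp only: nat_pow_eone[OF e] one)
    then show False using assms(2) by simp
  qed
  ultimately have "ord ?e = p" "\<forall>x\<in>carrier (Fp_power p n). ord x dvd p"
    using e assms(1) by (auto simp: prime_nat_iff)
  with e show ?thesis
    unfolding group_exponent_def
    by (metis (mono_tags, lifting) Lcm_least dvd_Lcm dvd_antisym image_iff)
qed

end

theory Submission
  imports Defs
begin

text \<open>
  Write \<open>n = m + 1\<close> and \<open>r = r(F\<^sub>p\<^sup>m)\<close>, and let \<open>A\<close> have at least \<open>2 p r\<close> elements. If some \<open>y \<in> A\<close> is the
  midpoint of \<open>(p - 1) / 2\<close> pairs of elements of \<open>A\<close>, then \<open>y\<close> and these pairs are \<open>p\<close> distinct
  elements with sum \<open>p y = 0\<close>. Suppose there is no such \<open>y\<close>, and consider the \<open>p\<^sup>m\<close> linear functionals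
  \<open>x\<^sub>m + (\<Sum>i<m. a\<^sub>i x\<^sub>i)\<close>. Each of them has \<open>p\<close> level sets, which are copies of \<open>F\<^sub>p\<^sup>m\<close>; so at most
  \<open>p r\<close> elements of \<open>A\<close>, hence at most half of them, are not midpoints of a progression in \<open>A\<close> on
  which the functional is constant. On the other hand, a given nonzero difference is killed by at
  most a fraction \<open>1 / p\<close> of the functionals, so a point with fewer than \<open>(p - 1) / 2\<close> pairs is such a
  midpoint for fewer than half of the functionals. Double counting gives a contradiction.
\<close>

section \<open>Coordinates modulo \<open>p\<close> and doubling\<close>

lemma carrier_Fp_power: "carrier (Fp_power p n) = {..<n} \<rightarrow>\<^sub>E {0..<int p}"
  by (auto simp: Fp_power_def product_group_def residue_ring_def intro!: PiE_cong)

lemma finite_carrier_Fp_power: "finite (carrier (Fp_power p n))"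
  by (simp add: carrier_Fp_power finite_PiE)

text \<open>Divisibility replaces equality of remainders here, so that later statements about
  functionals reduce to linear combinations of multiples of \<open>p\<close>.\<close>

lemma AP_eq_iff_Fp_power:
  assumes "p \<ge> 2" "y \<in> carrier (Fp_power p n)"
  shows "x \<otimes>\<^bsub>Fp_power p n\<^esub> z = y [^]\<^bsub>Fp_power p n\<^esub> (2 :: nat)
    \<longleftrightarrow> (\<forall>i<n. int p dvd x i + z i - 2 * y i)"
  unfolding pow_Fp_power[OF assms]
  by (auto simp: Fp_power_def product_group_def residue_ring_def fun_eq_iff restrict_def
      mod_eq_dvd_iff)

lemma eq_of_dvd_diff_Fp_power:
  assumes "x \<in> carrier (Fp_power p n)" "y \<in> carrier (Fp_power p n)" "i < n"
    and "int p dvd x i - y i"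
  shows "x i = y i"
proof -
  have "x i \<in> {0..<int p}" "y i \<in> {0..<int p}"
    using PiE_mem[of _ "{..<n}" "\<lambda>_. {0..<int p}" i] assms(1-3)
    unfolding carrier_Fp_power by blast+
  moreover have "x i mod int p = y i mod int p"
    using assms(4) by (simp only: mod_eq_dvd_iff)
  ultimately show ?thesis by simp
qed

text \<open>2 is invertible modulo an odd \<open>p\<close>. Hence reflection in \<open>y\<close>
  fixes only \<open>y\<close>, and the other points fall into genuine pairs.\<close>

lemma sq_inj_Fp_power:
  assumes "odd p" "p \<ge> 2" "x \<in> carrier (Fp_power p n)" "y \<in> carrier (Fp_power p n)"
    and "x \<otimes>\<^bsub>Fp_power p n\<^esub> x = y [^]\<^bsub>Fp_power p n\<^esub> (2 :: nat)"
  shows "x = y"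
proof -
  have "x i = y i" if "i < n" for i
  proof (rule eq_of_dvd_diff_Fp_power[OF assms(3,4) that])
    have "int p dvd x i + x i - 2 * y i"
      using assms(5) that by (simp add: AP_eq_iff_Fp_power[OF assms(2,4)])
    then have "int p dvd 2 * (x i - y i)" by (simp add: algebra_simps)
    moreover have "coprime (int p) 2" using assms(1) by simp
    ultimately show "int p dvd x i - y i" using coprime_dvd_mult_right_iff by blast
  qed
  then show ?thesis
    using assms(3,4) unfolding carrier_Fp_power by (intro PiE_ext) auto
qed

section \<open>Progression-free sets\<close>

lemma card_le_max_AP_free:
  assumes "finite (carrier G)" "A \<subseteq> carrier G" "\<not> (\<exists>T\<subseteq>A. three_term_AP G T)"
  shows "card A \<le> max_AP_free G"
proof -
  have "{card A |A. A \<subseteq> carrier G \<and> \<not> (\<exists>T\<subseteq>A. three_term_AP G T)} \<subseteq> card ` Pow (carrier G)"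
    by auto
  then have "finite {card A |A. A \<subseteq> carrier G \<and> \<not> (\<exists>T\<subseteq>A. three_term_AP G T)}"
    using assms(1) by (meson finite_Pow_iff finite_imageI finite_subset)
  then show ?thesis
    unfolding max_AP_free_def using assms(2,3) by (intro Max_ge) auto
qed

text \<open>A singleton contains no progression. This makes the set \<open>A\<close> of the counting
  argument nonempty, which its strict inequality relies on.\<close>

lemma max_AP_free_pos:
  assumes "finite (carrier G)" "x \<in> carrier G"
  shows "max_AP_free G > 0"
proof -
  have "card {x} \<le> max_AP_free G"
    using assms by (intro card_le_max_AP_free) (auto simp: three_term_AP_def)
  then show ?thesis by simp
qed

section \<open>Pairs with a given midpoint\<close>

text \<open>The points of \<open>A\<close> other than \<open>y\<close> whose mirror image 2y - x is
  in \<open>A\<close> too. Endpoints are counted, not pairs: where doubling is injective, the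
  cardinality is twice the number of pairs with midpoint \<open>y\<close>.\<close>

definition reflections :: "('a, 'b) monoid_scheme \<Rightarrow> 'a set \<Rightarrow> 'a \<Rightarrow> 'a set" where
  "reflections G A y = {x \<in> A. x \<noteq> y \<and> (\<exists>z\<in>A. x \<otimes>\<^bsub>G\<^esub> z = y [^]\<^bsub>G\<^esub> (2 :: nat))}"

text \<open>The mirror image of \<open>x\<close> differs from \<open>y\<close> by cancellation and
  from \<open>x\<close> by \<open>sq\<close>.\<close>

lemma (in comm_group) reflections_obtain:
  assumes "A \<subseteq> carrier G" "y \<in> carrier G"
    and sq: "\<forall>x\<in>carrier G. x \<otimes> x = y [^] (2 :: nat) \<longrightarrow> x = y"
    and "x \<in> reflections G A y"
  obtains z where "z \<in> reflections G A y" "z \<noteq> x" "x \<otimes> z = y [^] (2 :: nat)"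
proof -
  from assms(4) obtain z where z: "x \<in> A" "x \<noteq> y" "z \<in> A" "x \<otimes> z = y [^] (2 :: nat)"
    by (auto simp: reflections_def)
  then have c: "x \<in> carrier G" "z \<in> carrier G" using assms(1) by auto
  have "z \<noteq> y"
  proof
    assume "z = y"
    then have "x \<otimes> y = y \<otimes> y" using z(4) assms(2) by (simp add: numeral_2_eq_2)
    then show False using c assms(2) z(2) by simp
  qed
  moreover have "z \<noteq> x" using sq c z by auto
  moreover have "z \<otimes> x = y [^] (2 :: nat)" using c z(4) by (simp add: m_comm)
  ultimately show thesis using z by (intro that[of z]) (auto simp: reflections_def)
qed

text \<open>The last conjunct, closure under reflection in \<open>y\<close>, is only there to carry the induction.\<close>
lemma (in comm_group) reflections_paired_subset:
  assumes fin: "finite A" and A: "A \<subseteq> carrier G" and y: "y \<in> carrier G"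
    and sq: "\<forall>x\<in>carrier G. x \<otimes> x = y [^] (2 :: nat) \<longrightarrow> x = y"
    and "2 * k \<le> card (reflections G A y)"
  shows "\<exists>K\<subseteq>reflections G A y. card K = 2 * k \<and> finprod G (\<lambda>x. x) K = y [^] (2 * k) \<and>
    (\<forall>x\<in>K. \<forall>z\<in>A. x \<otimes> z = y [^] (2 :: nat) \<longrightarrow> z \<in> K)"
  using assms(5)
proof (induction k)
  case 0
  show ?case by (rule exI[of _ "{}"]) auto
next
  case (Suc k)
  let ?X = "reflections G A y"
  have XA: "?X \<subseteq> A" by (auto simp: reflections_def)
  from Suc obtain K where K: "K \<subseteq> ?X" "card K = 2 * k"
      "finprod G (\<lambda>x. x) K = y [^] (2 * k)"
      and closed: "\<And>x z. x \<in> K \<Longrightarrow> z \<in> A \<Longrightarrow> x \<otimes> z = y [^] (2 :: nat) \<Longrightarrow> z \<in> K"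
    by auto
  have finK: "finite K" using K(1) XA fin by (meson finite_subset)
  have "K \<noteq> ?X" using K(2) Suc.prems by auto
  then obtain x where x: "x \<in> ?X" "x \<notin> K" using K(1) by auto
  obtain z where z: "z \<in> ?X" "z \<noteq> x" "x \<otimes> z = y [^] (2 :: nat)"
    using reflections_obtain[OF A y sq x(1)] by blast
  have c: "x \<in> carrier G" "z \<in> carrier G" "K \<subseteq> carrier G" using x z K XA A by auto
  have zx: "z \<otimes> x = y [^] (2 :: nat)" using z(3) c by (simp add: m_comm)
  \<comment> \<open>\<open>x\<close> is the mirror image of \<open>z\<close>, so closure of
    \<open>K\<close> would put \<open>x\<close> into \<open>K\<close>.\<close>
  have "z \<notin> K" using closed[of z x] zx x XA by auto
  then have disj: "x \<notin> insert z K" using x z by auto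
  have "finprod G (\<lambda>x. x) (insert x (insert z K)) = x \<otimes> (z \<otimes> y [^] (2 * k))"
    using finK c disj \<open>z \<notin> K\<close> K(3) by (subst finprod_insert; auto)+
  also have "\<dots> = y [^] (2 :: nat) \<otimes> y [^] (2 * k)"
    using c y z(3) by (simp flip: m_assoc)
  also have "\<dots> = y [^] (2 * Suc k)" using y by (simp add: nat_pow_mult)
  finally have prod: "finprod G (\<lambda>x. x) (insert x (insert z K)) = y [^] (2 * Suc k)" .
  \<comment> \<open>Mirror images are unique, so adding \<open>x\<close> and \<open>z\<close>
    together keeps the set closed.\<close>
  have uniq: "b = b'" if "a \<otimes> b = y [^] (2 :: nat)" "a \<otimes> b' = y [^] (2 :: nat)"
    "a \<in> carrier G" "b \<in> carrier G" "b' \<in> carrier G" for a b b'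
    using that by (metis m_comm right_cancel)
  have "\<forall>x'\<in>insert x (insert z K). \<forall>z'\<in>A. x' \<otimes> z' = y [^] (2 :: nat) \<longrightarrow> z' \<in> insert x (insert z K)"
    using closed uniq[OF _ z(3)] uniq[OF _ zx] c A by blast
  with prod show ?case
    using K(1,2) x z finK disj \<open>z \<notin> K\<close>
    by (intro exI[of _ "insert x (insert z K)"]) auto
qed

section \<open>Linear functionals and their level sets\<close>

text \<open>
  The coefficient of the last coordinate is \<open>1\<close>, so that dropping this coordinate is injective on
  level sets.
\<close>
definition functional :: "nat \<Rightarrow> nat \<Rightarrow> (nat \<Rightarrow> int) \<Rightarrow> (nat \<Rightarrow> int) \<Rightarrow> int" where
  "functional p m a x = (x m + (\<Sum>i<m. a i * x i)) mod int p"

lemma functional_eq_iff: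
  "functional p m a x = functional p m a y
    \<longleftrightarrow> int p dvd x m - y m + (\<Sum>i<m. a i * (x i - y i))"
  by (simp add: functional_def mod_eq_dvd_iff algebra_simps sum_subtractf)

text \<open>By linearity the functional changes from \<open>y\<close> to \<open>z\<close> by the
  negative of its change from \<open>y\<close> to \<open>x\<close>. So reflections on the level set
  of \<open>y\<close> also come in pairs.\<close>

lemma functional_AP:
  assumes "p \<ge> 2" "y \<in> carrier (Fp_power p (Suc m))"
    and "x \<otimes>\<^bsub>Fp_power p (Suc m)\<^esub> z = y [^]\<^bsub>Fp_power p (Suc m)\<^esub> (2 :: nat)"
    and "functional p m a x = functional p m a y"
  shows "functional p m a z = functional p m a y"
proof -
  have d: "int p dvd x i + z i - 2 * y i" if "i \<le> m" for i
    using assms(3) that by (simp add: AP_eq_iff_Fp_power[OF assms(1,2)])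
  have "int p dvd (x m + z m - 2 * y m) + (\<Sum>i<m. a i * (x i + z i - 2 * y i))"
    by (intro dvd_add dvd_sum dvd_mult[OF d] d) auto
  then have "int p dvd (x m + z m - 2 * y m) + (\<Sum>i<m. a i * (x i + z i - 2 * y i))
      - (x m - y m + (\<Sum>i<m. a i * (x i - y i)))"
    using assms(4) unfolding functional_eq_iff by (rule dvd_diff)
  also have "\<dots> = z m - y m + (\<Sum>i<m. a i * (z i - y i))"
    by (simp add: algebra_simps sum_subtractf sum.distrib sum_distrib_left)
  finally show ?thesis by (simp add: functional_eq_iff)
qed

text \<open>Summing the functional's differences from \<open>y\<close> at \<open>x\<close> and
  \<open>z\<close> and removing the contribution of the first \<open>m\<close> coordinates leaves
  exactly the progression condition at coordinate \<open>m\<close>, whose coefficient is 1.\<close>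

lemma AP_of_restrict_AP:
  assumes "p \<ge> 2" "y \<in> carrier (Fp_power p (Suc m))"
    and "restrict y {..<m} \<in> carrier (Fp_power p m)"
    and "restrict x {..<m} \<otimes>\<^bsub>Fp_power p m\<^esub> restrict z {..<m}
      = restrict y {..<m} [^]\<^bsub>Fp_power p m\<^esub> (2 :: nat)"
    and "functional p m a x = functional p m a y" "functional p m a z = functional p m a y"
  shows "x \<otimes>\<^bsub>Fp_power p (Suc m)\<^esub> z = y [^]\<^bsub>Fp_power p (Suc m)\<^esub> (2 :: nat)"
proof -
  have d: "int p dvd x i + z i - 2 * y i" if "i < m" for i
    using assms(4) that by (simp add: AP_eq_iff_Fp_power[OF assms(1,3)])
  have "int p dvd (x m - y m + (\<Sum>i<m. a i * (x i - y i)))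
      + (z m - y m + (\<Sum>i<m. a i * (z i - y i)))
      - (\<Sum>i<m. a i * (x i + z i - 2 * y i))"
    using assms(5,6) unfolding functional_eq_iff
    by (rule dvd_diff[OF dvd_add dvd_sum[OF dvd_mult[OF d]]]) auto
  also have "\<dots> = x m + z m - 2 * y m"
    by (simp add: algebra_simps sum_subtractf sum.distrib sum_distrib_left)
  finally show ?thesis
    using d by (auto simp: AP_eq_iff_Fp_power[OF assms(1,2)] less_Suc_eq)
qed

lemma restrict_Fp_power:
  "x \<in> carrier (Fp_power p (Suc m)) \<Longrightarrow> restrict x {..<m} \<in> carrier (Fp_power p m)"
  unfolding carrier_Fp_power restrict_PiE_iff
  by (metis PiE_mem lessThan_iff less_SucI)

lemma inj_on_restrict_functional:
  "inj_on (\<lambda>x. restrict x {..<m}) {x \<in> carrier (Fp_power p (Suc m)). functional p m a x = c}"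
proof (rule inj_onI, clarsimp)
  fix x y
  assume x: "x \<in> carrier (Fp_power p (Suc m))" and y: "y \<in> carrier (Fp_power p (Suc m))"
    and eq: "restrict x {..<m} = restrict y {..<m}"
    and f: "functional p m a y = functional p m a x"
  have e: "x i = y i" if "i < m" for i
    using fun_cong[OF eq, of i] that by simp
  have "int p dvd x m - y m"
    using f[symmetric] e by (simp add: functional_eq_iff)
  then have "x m = y m" by (intro eq_of_dvd_diff_Fp_power[OF x y]) auto
  with e show "x = y"
    using x y unfolding carrier_Fp_power by (intro PiE_ext) (auto simp: less_Suc_eq)
qed

text \<open>If \<open>x\<close> and \<open>y\<close> differ only in coordinate \<open>m\<close>, no
  functional identifies them. If they differ at some \<open>j < m\<close>, the equation can be
  solved for the coefficient at \<open>j\<close>, leaving \<open>m - 1\<close> free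
  coefficients.\<close>

lemma card_functional_eq_le:
  assumes p: "prime p" and x: "x \<in> carrier (Fp_power p (Suc m))"
    and y: "y \<in> carrier (Fp_power p (Suc m))" and "x \<noteq> y"
  shows "card {a \<in> carrier (Fp_power p m). functional p m a x = functional p m a y} \<le> p ^ (m - 1)"
    (is "card ?S \<le> _")
proof (cases "\<forall>j<m. x j = y j")
  case True
  have "?S = {}"
  proof (rule ccontr)
    assume "?S \<noteq> {}"
    then obtain a where "functional p m a x = functional p m a y" by auto
    moreover have "restrict x {..<m} = restrict y {..<m}" using True by auto
    ultimately show False
      using inj_onD[OF inj_on_restrict_functional[of m p a "functional p m a y"]] x y \<open>x \<noteq> y\<close> by auto
  qed
  then show ?thesis by (simp only: card.empty le0)
next
  case False
  then obtain j where j: "j < m" "x j \<noteq> y j" by auto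
  let ?I = "{..<m} - {j}"
  \<comment> \<open>Subtracting the conditions for \<open>a\<close> and \<open>b\<close> leaves only
    the term at \<open>j\<close>, where \<open>p\<close> cannot divide
    \<open>x j - y j\<close>.\<close>
  have "inj_on (\<lambda>a. restrict a ?I) ?S"
  proof (rule inj_onI, clarsimp)
    fix a b
    assume a: "a \<in> carrier (Fp_power p m)" and b: "b \<in> carrier (Fp_power p m)"
      and eq: "restrict a ?I = restrict b ?I"
      and fa: "functional p m a x = functional p m a y"
      and fb: "functional p m b x = functional p m b y"
    have e: "a i = b i" if "i < m" "i \<noteq> j" for i
      using fun_cong[OF eq, of i] that by simp
    have "int p dvd (x m - y m + (\<Sum>i<m. a i * (x i - y i)))
        - (x m - y m + (\<Sum>i<m. b i * (x i - y i)))"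
      using fa fb by (intro dvd_diff) (auto simp: functional_eq_iff)
    also have "\<dots> = (\<Sum>i<m. (a i - b i) * (x i - y i))"
      by (simp add: algebra_simps sum_subtractf sum.distrib)
    also have "\<dots> = (\<Sum>i\<in>{j}. (a i - b i) * (x i - y i))"
      using j e by (intro sum.mono_neutral_right) auto
    finally have "int p dvd (a j - b j) * (x j - y j)" by simp
    moreover have "\<not> int p dvd x j - y j"
      using eq_of_dvd_diff_Fp_power[OF x y, of j] j by auto
    ultimately have "int p dvd a j - b j"
      using p by (simp add: prime_dvd_mult_iff)
    then have "a j = b j" by (rule eq_of_dvd_diff_Fp_power[OF a b j(1)])
    with e show "a = b"
      using a b unfolding carrier_Fp_power by (intro PiE_ext) auto
  qed
  moreover have "(\<lambda>a. restrict a ?I) ` ?S \<subseteq> ?I \<rightarrow>\<^sub>E {0..<int p}"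
    unfolding carrier_Fp_power
    by (intro image_subsetI) (metis (no_types, lifting) Diff_iff PiE_mem mem_Collect_eq restrict_PiE_iff)
  ultimately have "card ?S \<le> card (?I \<rightarrow>\<^sub>E {0..<int p})"
    by (intro card_inj_on_le[of "\<lambda>a. restrict a ?I"] finite_PiE) auto
  also have "\<dots> = p ^ (m - 1)" using j by (simp add: card_PiE)
  finally show ?thesis .
qed

section \<open>Double counting points against functionals\<close>

text \<open>Each of the \<open>p\<close> level sets of \<open>?B\<close> projects injectively onto a
  progression-free set: a progression downstairs would lift to one in the same level set, making its
  midpoint violate the condition of \<open>?B\<close>.\<close>

lemma card_no_reflection_le:
  assumes "p \<ge> 2" and A: "A \<subseteq> carrier (Fp_power p (Suc m))"
  shows "card {y \<in> A. \<forall>x\<in>reflections (Fp_power p (Suc m)) A y. functional p m a x \<noteq> functional p m a y}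
    \<le> p * max_AP_free (Fp_power p m)" (is "card ?B \<le> _")
proof -
  let ?L = "\<lambda>c. {y \<in> ?B. functional p m a y = c}"
  let ?\<pi> = "\<lambda>x. restrict x {..<m} :: nat \<Rightarrow> int"
  have "card (?L c) \<le> max_AP_free (Fp_power p m)" for c
  proof -
    have inj: "inj_on ?\<pi> (?L c)"
      by (rule inj_on_subset[OF inj_on_restrict_functional[of m p a c]]) (use A in auto)
    have "\<not> (\<exists>T\<subseteq>?\<pi> ` ?L c. three_term_AP (Fp_power p m) T)"
    proof
      assume "\<exists>T\<subseteq>?\<pi> ` ?L c. three_term_AP (Fp_power p m) T"
      then obtain x y z where xyz: "x \<in> ?L c" "y \<in> ?L c" "z \<in> ?L c" "?\<pi> x \<noteq> ?\<pi> y"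
          "?\<pi> x \<otimes>\<^bsub>Fp_power p m\<^esub> ?\<pi> z = ?\<pi> y [^]\<^bsub>Fp_power p m\<^esub> (2 :: nat)"
        unfolding three_term_AP_def by (smt (verit) image_iff insert_subset)
      have y: "y \<in> carrier (Fp_power p (Suc m))" using xyz A by auto
      have "x \<otimes>\<^bsub>Fp_power p (Suc m)\<^esub> z = y [^]\<^bsub>Fp_power p (Suc m)\<^esub> (2 :: nat)"
        using AP_of_restrict_AP[OF assms(1) y restrict_Fp_power[OF y] xyz(5), of a] xyz(1-3) by auto
      then have "x \<in> reflections (Fp_power p (Suc m)) A y"
        using xyz by (auto simp: reflections_def)
      then show False using xyz by auto
    qed
    moreover have "?\<pi> ` ?L c \<subseteq> carrier (Fp_power p m)"
      using A by (auto intro!: restrict_Fp_power)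
    ultimately have "card (?\<pi> ` ?L c) \<le> max_AP_free (Fp_power p m)"
      by (intro card_le_max_AP_free finite_carrier_Fp_power)
    then show ?thesis by (simp only: card_image[OF inj])
  qed
  note L = this
  have "card ?B = card (\<Union>c\<in>{0..<int p}. ?L c)"
    using assms(1) by (intro arg_cong[where f = card]) (auto simp: functional_def)
  also have "\<dots> \<le> (\<Sum>c\<in>{0..<int p}. card (?L c))"
    by (rule card_UN_le) simp
  also have "\<dots> \<le> (\<Sum>c\<in>{0..<int p}. max_AP_free (Fp_power p m))"
    by (intro sum_mono L)
  finally show ?thesis by simp
qed

lemma double_count:
  assumes "finite A" "finite B"
  shows "(\<Sum>a\<in>A. card {b \<in> B. P a b}) = (\<Sum>b\<in>B. card {a \<in> A. P a b})"
  using assms by (rule sum_multicount_gen) auto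

lemma exists_many_reflections:
  assumes p: "prime p" "odd p" and "m \<ge> 1"
    and A: "A \<subseteq> carrier (Fp_power p (Suc m))"
    and N: "2 * p * max_AP_free (Fp_power p m) \<le> card A"
  shows "\<exists>y\<in>A. p - 1 \<le> card (reflections (Fp_power p (Suc m)) A y)"
proof (rule ccontr)
  let ?G = "Fp_power p (Suc m)" and ?P = "carrier (Fp_power p m)"
  let ?f = "functional p m"
  let ?X = "reflections ?G A"
  let ?good = "\<lambda>a y. \<exists>x\<in>?X y. ?f a x = ?f a y"
  assume "\<not> ?thesis"
  then have small: "card (?X y) \<le> p - 2" if "y \<in> A" for y
    using that by force
  have p2: "p \<ge> 2" using p(1) by (rule prime_ge_2_nat)
  interpret comm_group ?G by (rule comm_group_Fp_power[OF p2])
  interpret H: comm_group "Fp_power p m" by (rule comm_group_Fp_power[OF p2])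
  have fin: "finite A" "finite ?P" "finite (?X y)" for y
    using A finite_carrier_Fp_power by (auto simp: reflections_def intro: finite_subset)
  have Apos: "card A > 0"
    using N p2 max_AP_free_pos[OF finite_carrier_Fp_power H.one_closed]
    by (metis gr0I le_zero_eq mult_is_0 not_numeral_le_zero less_numeral_extra(3) zero_neq_numeral)
  have "2 * card {a \<in> ?P. ?good a y} < p ^ m" if y: "y \<in> A" for y
  proof -
    have yc: "y \<in> carrier ?G" using y A by auto
    have sq: "\<forall>x\<in>carrier ?G. x \<otimes>\<^bsub>?G\<^esub> x = y [^]\<^bsub>?G\<^esub> (2 :: nat) \<longrightarrow> x = y"
      using sq_inj_Fp_power[OF p(2) p2 _ yc] by blast
    \<comment> \<open>A reflection on the level set brings its mirror image along. This factor 2 is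
      what pushes the proportion of good functionals below one half.\<close>
    have two: "2 \<le> card {x \<in> ?X y. ?f a x = ?f a y}" if "?good a y" for a
    proof -
      from that obtain x where x: "x \<in> ?X y" "?f a x = ?f a y" by auto
      obtain z where z: "z \<in> ?X y" "z \<noteq> x" "x \<otimes>\<^bsub>?G\<^esub> z = y [^]\<^bsub>?G\<^esub> (2 :: nat)"
        using reflections_obtain[OF A yc sq x(1)] by blast
      have "?f a z = ?f a y" by (rule functional_AP[OF p2 yc z(3) x(2)])
      then have "{x, z} \<subseteq> {x \<in> ?X y. ?f a x = ?f a y}" using x z by auto
      then have "card {x, z} \<le> card {x \<in> ?X y. ?f a x = ?f a y}"
        by (intro card_mono) (auto simp: fin)
      then show ?thesis using z(2) by simp
    qed
    have "2 * card {a \<in> ?P. ?good a y} = (\<Sum>a\<in>{a \<in> ?P. ?good a y}. 2)" by simp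
    also have "\<dots> \<le> (\<Sum>a\<in>{a \<in> ?P. ?good a y}. card {x \<in> ?X y. ?f a x = ?f a y})"
      by (intro sum_mono two) auto
    also have "\<dots> \<le> (\<Sum>a\<in>?P. card {x \<in> ?X y. ?f a x = ?f a y})"
      by (intro sum_mono2) (auto simp: fin)
    also have "\<dots> = (\<Sum>x\<in>?X y. card {a \<in> ?P. ?f a x = ?f a y})"
      by (intro double_count fin)
    also have "\<dots> \<le> (\<Sum>x\<in>?X y. p ^ (m - 1))"
      by (intro sum_mono card_functional_eq_le p) (use A yc in \<open>auto simp: reflections_def\<close>)
    also have "\<dots> \<le> (p - 2) * p ^ (m - 1)" using small[OF y] by simp
    \<comment> \<open>Strictness enters here, through \<open>p - 2 < p\<close>.\<close>
    also have "\<dots> < p * p ^ (m - 1)" using p2 by simp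
    also have "\<dots> = p ^ m" using \<open>m \<ge> 1\<close> by (simp flip: power_Suc)
    finally show ?thesis .
  qed
  then have "(\<Sum>y\<in>A. 2 * card {a \<in> ?P. ?good a y}) < (\<Sum>y\<in>A. p ^ m)"
    using Apos by (intro sum_strict_mono) (auto simp: fin card_gt_0_iff)
  then have upper: "2 * (\<Sum>a\<in>?P. card {y \<in> A. ?good a y}) < card A * p ^ m"
    by (simp add: double_count[OF fin(2,1)] sum_distrib_left)
  \<comment> \<open>For every functional the points that are not good number at most half of
    \<open>card A\<close>, by \<open>N\<close>.\<close>
  have "card A \<le> 2 * card {y \<in> A. ?good a y}" for a
  proof -
    have "card A = card ({y \<in> A. ?good a y} \<union> {y \<in> A. \<forall>x\<in>?X y. ?f a x \<noteq> ?f a y})"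
      by (rule arg_cong[where f = card]) auto
    also have "\<dots> \<le> card {y \<in> A. ?good a y} + card {y \<in> A. \<forall>x\<in>?X y. ?f a x \<noteq> ?f a y}"
      by (rule card_Un_le)
    finally show ?thesis using card_no_reflection_le[OF p2 A, of a] N by linarith
  qed
  then have "(\<Sum>a\<in>?P. card A) \<le> (\<Sum>a\<in>?P. 2 * card {y \<in> A. ?good a y})"
    by (intro sum_mono)
  then have "card A * p ^ m \<le> 2 * (\<Sum>a\<in>?P. card {y \<in> A. ?good a y})"
    using order_Fp_power[of p m] by (simp add: order_def sum_distrib_left mult.commute)
  with upper show False by simp
qed

section \<open>From many reflections to a zero-sum set\<close>

theorem theorem3:
  fixes p n :: nat
  assumes "prime p" and "p \<ge> 3" and "n \<ge> 2"
  shows "zero_sum_const (Fp_power p n) \<le> 2 * p * max_AP_free (Fp_power p (n - 1))"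
proof -
  define m where "m = n - 1"
  have n: "n = Suc m" "m \<ge> 1" using assms(3) by (auto simp: m_def)
  have p: "odd p" "p \<ge> 2" using assms prime_odd_nat[of p] by auto
  let ?G = "Fp_power p n"
  interpret comm_group ?G by (rule comm_group_Fp_power[OF p(2)])
  have "\<exists>S\<subseteq>A. card S = p \<and> finprod ?G (\<lambda>x. x) S = \<one>\<^bsub>?G\<^esub>"
    if A: "A \<subseteq> carrier ?G" and N: "2 * p * max_AP_free (Fp_power p (n - 1)) \<le> card A" for A
  proof -
    obtain y where y: "y \<in> A" "p - 1 \<le> card (reflections ?G A y)"
      using exists_many_reflections[OF assms(1) p(1) n(2), of A] A N n by auto
    have yc: "y \<in> carrier ?G" using y A by auto
    have fin: "finite A" using A finite_carrier_Fp_power by (rule finite_subset)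
    \<comment> \<open>\<open>p - 1\<close> is even, so whole pairs together with their midpoint
      \<open>y\<close> give exactly \<open>p\<close> elements.\<close>
    have k: "2 * ((p - 1) div 2) = p - 1" using p by simp
    have sq: "\<forall>x\<in>carrier ?G. x \<otimes>\<^bsub>?G\<^esub> x = y [^]\<^bsub>?G\<^esub> (2 :: nat) \<longrightarrow> x = y"
      using sq_inj_Fp_power[OF p _ yc] by blast
    obtain K where K: "K \<subseteq> reflections ?G A y" "card K = p - 1"
        "finprod ?G (\<lambda>x. x) K = y [^]\<^bsub>?G\<^esub> (p - 1)"
      using reflections_paired_subset[OF fin A yc sq, of "(p - 1) div 2"] y(2) k by auto
    have KA: "K \<subseteq> A" "y \<notin> K" "finite K"
      using K(1) fin by (auto simp: reflections_def intro: finite_subset)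
    have "finprod ?G (\<lambda>x. x) (insert y K) = y \<otimes>\<^bsub>?G\<^esub> y [^]\<^bsub>?G\<^esub> (p - 1)"
      using KA A yc K(3) by (subst finprod_insert) auto
    also have "\<dots> = y [^]\<^bsub>?G\<^esub> Suc (p - 1)"
      using yc by (simp add: m_comm)
    also have "Suc (p - 1) = p" using p by simp
    also have "y [^]\<^bsub>?G\<^esub> p = \<one>\<^bsub>?G\<^esub>"
      using pow_Fp_power[OF p(2) yc] by (simp add: Fp_power_def product_group_def residue_ring_def)
    finally show ?thesis
      using KA K(2) p(2) y(1) by (intro exI[of _ "insert y K"]) auto
  qed
  then show ?thesis
    unfolding zero_sum_const_def
    using assms by (intro Least_le) (auto simp: group_exponent_Fp_power)
qed

end
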